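(* Let $\mathcal Z,T,Z,\|\cdot\|,w,m,M$ be as in the context, and consider Framework 2 (described in the context) with input $(z_0,\eta_0,\mathcal D)\in Z\times\mathbb R_+\times\mathbb R_{++}$ and $(\sigma,\tau,\lambda,\rho,\varepsilon)\in[0,1)\times(0,1)\times\mathbb R_{++}\times\mathbb R_{++}\times\mathbb R_{++}$. Let $d_0:=\inf_{z\in T^{-1}(0)}(dw)_{z_0}(z)$. Then: (a) Framework 2 terminates in at most $$\max\left\{\frac Mm\left(\frac{\mathcal D}{\lambda\rho}+\frac1{1-\sigma}\right),\frac1\tau\right\}\left[2+\max\left\{\log^+\left(\frac{32M^2(d_0+\eta_0)}{(\lambda\rho)^2m}\right),\log^+\left(\frac{d_0+\eta_0}{\lambda(1-\sigma)\varepsilon}\right)\right\}\right]$$ iterations with a triple $(\tilde z_k,\tilde r_k,\varepsilon_k)$ satisfying $$\tilde r_k\in T^{[\varepsilon_k]}(\tilde z_k),\qquad\|\tilde r_k+\mu\nabla(dw)_{z_0}(\tilde z_k)\|^*\le\rho/2,\qquad\varepsilon_k\le\varepsilon;$$ (b) for every $k\ge1$ (i.e. every iteration performed), $$\|\nabla(dw)_{z_0}(\tilde z_k)\|^*\le\mathcal D_0:=\frac{\sqrt2M}{\sqrt m}\left[2+\frac1{\sqrt{1-\sigma}}\right](d_0+\eta_0)^{1/2};$$ (c) if $\mathcal D\ge2\mathcal D_0$, then the output satisfies $\|\tilde r_k\|^*\le\rho$.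
   Context: $\mathcal Z$ is a finite-dimensional real inner product space. A proper lower semicontinuous convex $w:\mathcal Z\to[-\infty,\infty]$ is a distance generating function if $\mathrm{int}(\mathrm{dom}\,w)=\mathrm{Dom}(\partial w)\ne\emptyset$ and $w$ is continuously differentiable on this interior; its Bregman distance is $(dw)_z(z')=w(z')-w(z)-\langle\nabla w(z),z'-z\rangle$ for $z\in\mathrm{int}(\mathrm{dom}\,w)$, $z'\in\mathcal Z$; $\nabla(dw)_z(z')=\nabla w(z')-\nabla w(z)$. For a seminorm $\|\cdot\|$ on $\mathcal Z$, $\|v\|^*=\sup\{\langle v,z\rangle:\|z\|\le1\}\in[0,\infty]$. Given a convex set $Z\subset\mathrm{int}(\mathrm{dom}\,w)$ and constants $m,M>0$, $w$ is $(m,M)$-regular with respect to $(Z,\|\cdot\|)$ if $(dw)_z(z')\ge\frac m2\|z-z'\|^2$ and $\|\nabla w(z)-\nabla w(z')\|^*\le M\|z-z'\|$ for all $z,z'\in Z$. For a monotone $T:\mathcal Z\rightrightarrows\mathcal Z$ and $\varepsilon\ge0$, $T^{[\varepsilon]}(z)=\{v:\langle v-v',z-z'\rangle\ge-\varepsilon\ \forall z'\in\mathcal Z,\ \forall v'\in T(z')\}$. $\log^+(t)=\max\{\log t,0\}$, with $\log^+(0)=0$. Standing assumptions: $T:\mathcal Z\rightrightarrows\mathcal Z$ is maximal monotone with $T^{-1}(0)\ne\emptyset$; $w$ is $(m,M)$-regular with respect to $(Z,\|\cdot\|)$, where $Z\subset\mathrm{int}(\mathrm{dom}\,w)$ is convex,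 $\mathrm{Dom}(T)\subset Z$, and $\|\cdot\|$ is a seminorm on $\mathcal Z$; and for every $\mu>0$ the set $Z_\mu^*=\{z\in Z:0\in T(z)+\mu\nabla(dw)_{z_0}(z)\}$ is nonempty. Framework 2: set $\mu=\rho/\mathcal D$ and, for $k=1,2,\dots$, choose $\lambda_k\ge\lambda$ and find (by any means; it is understood that such a tuple is found) $(z_k,\tilde z_k,\varepsilon_k,\eta_k)\in Z\times Z\times\mathbb R_+\times\mathbb R_+$ such that $$r_k:=\tfrac1{\lambda_k}\nabla(dw)_{z_k}(z_{k-1})\in\mu\nabla(dw)_{z_0}(\tilde z_k)+T^{[\varepsilon_k]}(\tilde z_k),$$ $$(dw)_{z_k}(\tilde z_k)+\lambda_k\varepsilon_k+\eta_k\le\sigma(dw)_{z_{k-1}}(\tilde z_k)+(1-\tau)\eta_{k-1};$$ if $\|r_k\|^*\le\rho/2$ and $\varepsilon_k\le\varepsilon$, stop and output $(\tilde z_k,\tilde r_k,\varepsilon_k)$ with $\tilde r_k=r_k-\mu\nabla(dw)_{z_0}(\tilde z_k)$; otherwise continue with $k+1$. *)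

theory Defs
  imports "HOL-Analysis.Analysis"
begin

section \<open>Extended-real-valued convex functions and Bregman distances\<close>

definition eff_dom :: "('a \<Rightarrow> ereal) \<Rightarrow> 'a set" where
  "eff_dom w = {z. w z < \<infinity>}"

definition proper_fun :: "('a \<Rightarrow> ereal) \<Rightarrow> bool" where
  "proper_fun w \<longleftrightarrow> eff_dom w \<noteq> {} \<and> (\<forall>z. w z \<noteq> -\<infinity>)"

definition lsc_fun :: "('a::topological_space \<Rightarrow> ereal) \<Rightarrow> bool" where
  "lsc_fun w \<longleftrightarrow> (\<forall>z. w z \<le> Liminf (at z) w)"

definition convex_fun :: "('a::real_vector \<Rightarrow> ereal) \<Rightarrow> bool" where
  "convex_fun w \<longleftrightarrow> convex {(z, r :: real). w z \<le> ereal r}"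

definition subdiff :: "('a::real_inner \<Rightarrow> ereal) \<Rightarrow> 'a \<Rightarrow> 'a set" where
  "subdiff w z = {v. \<forall>z'. w z + ereal (v \<bullet> (z' - z)) \<le> w z'}"

text \<open>The domain of a set-valued operator.\<close>

definition op_dom :: "('a \<Rightarrow> 'a set) \<Rightarrow> 'a set" where
  "op_dom T = {z. T z \<noteq> {}}"

text \<open>The gradient is only meaningful at points around which \<open>w\<close> is finite and at which it is
  differentiable; it is used for points of the interior of the effective domain only.\<close>

definition grad :: "('a::real_inner \<Rightarrow> ereal) \<Rightarrow> 'a \<Rightarrow> 'a" where
  "grad w z = (THE g. GDERIV (\<lambda>x. real_of_ereal (w x)) z :> g)"

definition dist_gen_fun :: "('a::real_inner \<Rightarrow> ereal) \<Rightarrow> bool" where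
  "dist_gen_fun w \<longleftrightarrow>
     proper_fun w \<and> lsc_fun w \<and> convex_fun w \<and>
     interior (eff_dom w) = op_dom (subdiff w) \<and> interior (eff_dom w) \<noteq> {} \<and>
     (\<forall>z\<in>interior (eff_dom w). \<exists>g. GDERIV (\<lambda>x. real_of_ereal (w x)) z :> g) \<and>
     continuous_on (interior (eff_dom w)) (grad w)"

text \<open>\<open>bregman w z z'\<close> is $(dw)_z(z')$; so \<open>grad (bregman w z) z'\<close> is $\nabla(dw)_z(z')$.\<close>

definition bregman :: "('a::real_inner \<Rightarrow> ereal) \<Rightarrow> 'a \<Rightarrow> 'a \<Rightarrow> ereal" where
  "bregman w z z' = w z' - w z - ereal (grad w z \<bullet> (z' - z))"

section \<open>Seminorms and regularity\<close>

definition is_seminorm :: "('a::real_vector \<Rightarrow> real) \<Rightarrow> bool" where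
  "is_seminorm p \<longleftrightarrow> (\<forall>x y. p (x + y) \<le> p x + p y) \<and> (\<forall>c x. p (c *\<^sub>R x) = \<bar>c\<bar> * p x)"

definition dual_seminorm :: "('a::real_inner \<Rightarrow> real) \<Rightarrow> 'a \<Rightarrow> ereal" where
  "dual_seminorm p v = (SUP z\<in>{z. p z \<le> 1}. ereal (v \<bullet> z))"

definition regular_wrt ::
  "real \<Rightarrow> real \<Rightarrow> ('a::real_inner \<Rightarrow> ereal) \<Rightarrow> 'a set \<Rightarrow> ('a \<Rightarrow> real) \<Rightarrow> bool" where
  "regular_wrt m M w Z p \<longleftrightarrow>
     (\<forall>z\<in>Z. \<forall>z'\<in>Z. bregman w z z' \<ge> ereal (m / 2 * (p (z - z'))\<^sup>2) \<and>
        dual_seminorm p (grad w z - grad w z') \<le> ereal (M * p (z - z')))"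

section \<open>Monotone operators\<close>

definition monotone_op :: "('a::real_inner \<Rightarrow> 'a set) \<Rightarrow> bool" where
  "monotone_op T \<longleftrightarrow> (\<forall>z z'. \<forall>v\<in>T z. \<forall>v'\<in>T z'. (v - v') \<bullet> (z - z') \<ge> 0)"

definition maximal_monotone :: "('a::real_inner \<Rightarrow> 'a set) \<Rightarrow> bool" where
  "maximal_monotone T \<longleftrightarrow>
     monotone_op T \<and> (\<forall>S. monotone_op S \<and> (\<forall>z. T z \<subseteq> S z) \<longrightarrow> S = T)"

definition enlargement :: "('a::real_inner \<Rightarrow> 'a set) \<Rightarrow> real \<Rightarrow> 'a \<Rightarrow> 'a set" where
  "enlargement T \<epsilon> z = {v. \<forall>z'. \<forall>v'\<in>T z'. (v - v') \<bullet> (z - z') \<ge> - \<epsilon>}"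

definition op_zeros :: "('a::zero \<Rightarrow> 'a set) \<Rightarrow> 'a set" where
  "op_zeros T = {z. 0 \<in> T z}"

section \<open>The framework\<close>

definition log_plus :: "real \<Rightarrow> real" where
  "log_plus t = (if t = 0 then 0 else max (ln t) 0)"

text \<open>\<open>step_residual w lam y x\<close> is $r = \frac1\lambda\nabla(dw)_x(y)$, with
  \<open>y\<close> the previous iterate and \<open>x\<close> the new one.\<close>

definition step_residual :: "('a::real_inner \<Rightarrow> ereal) \<Rightarrow> real \<Rightarrow> 'a \<Rightarrow> 'a \<Rightarrow> 'a" where
  "step_residual w lam y x = (1 / lam) *\<^sub>R grad (bregman w x) y"

text \<open>One iteration, with base point \<open>z0\<close>, from the state \<open>(y, \<eta>')\<close> to the state \<open>(x, \<eta>)\<close>, with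
  stepsize \<open>l\<close>, auxiliary point \<open>xt\<close> (written $\tilde z_k$ on paper) and enlargement
  parameter \<open>e\<close>. All Bregman distances are finite here, as the points lie in \<open>Z\<close>.\<close>

definition admissible_step ::
  "('a::real_inner \<Rightarrow> ereal) \<Rightarrow> ('a \<Rightarrow> 'a set) \<Rightarrow> 'a set \<Rightarrow> real \<Rightarrow> real \<Rightarrow> real \<Rightarrow> real \<Rightarrow> 'a
    \<Rightarrow> 'a \<Rightarrow> real \<Rightarrow> real \<Rightarrow> 'a \<Rightarrow> 'a \<Rightarrow> real \<Rightarrow> real \<Rightarrow> bool" where
  "admissible_step w T Z \<mu> \<sigma> \<tau> lam z0 y \<eta>' l x xt e \<eta> \<longleftrightarrow>
     lam \<le> l \<and> x \<in> Z \<and> xt \<in> Z \<and> 0 \<le> e \<and> 0 \<le> \<eta> \<and>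
     step_residual w l y x \<in> (\<lambda>v. \<mu> *\<^sub>R grad (bregman w z0) xt + v) ` enlargement T e xt \<and>
     bregman w x xt + ereal (l * e + \<eta>)
       \<le> ereal \<sigma> * bregman w y xt + ereal ((1 - \<tau>) * \<eta>')"

definition stop_test ::
  "('a::real_inner \<Rightarrow> real) \<Rightarrow> real \<Rightarrow> real \<Rightarrow> 'a \<Rightarrow> real \<Rightarrow> bool" where
  "stop_test p \<rho> \<epsilon> r e \<longleftrightarrow> dual_seminorm p r \<le> ereal (\<rho> / 2) \<and> e \<le> \<epsilon>"

text \<open>A run performs the iterations \<open>1, \<dots>, K\<close>, where a priori \<open>K = \<infinity>\<close> is possible. It does not
  end before the stopping test succeeds and ends as soon as it does. Index \<open>0\<close>
  of \<open>zs\<close> and \<open>\<eta>s\<close> holds the input; index \<open>0\<close> of the other sequences and indices beyond \<open>K\<close>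
  are irrelevant.\<close>

definition framework_run ::
  "('a::real_inner \<Rightarrow> ereal) \<Rightarrow> ('a \<Rightarrow> 'a set) \<Rightarrow> 'a set \<Rightarrow> ('a \<Rightarrow> real)
    \<Rightarrow> 'a \<Rightarrow> real \<Rightarrow> real \<Rightarrow> real \<Rightarrow> real \<Rightarrow> real \<Rightarrow> real \<Rightarrow> real
    \<Rightarrow> enat \<Rightarrow> (nat \<Rightarrow> real) \<Rightarrow> (nat \<Rightarrow> 'a) \<Rightarrow> (nat \<Rightarrow> 'a) \<Rightarrow> (nat \<Rightarrow> real) \<Rightarrow> (nat \<Rightarrow> real) \<Rightarrow> bool"
  where
  "framework_run w T Z p z0 \<eta>0 D \<sigma> \<tau> lam \<rho> \<epsilon> K ls zs zts es \<eta>s \<longleftrightarrow>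
     zs 0 = z0 \<and> \<eta>s 0 = \<eta>0 \<and> 1 \<le> K \<and>
     (\<forall>k\<ge>1. enat k \<le> K \<longrightarrow>
        admissible_step w T Z (\<rho> / D) \<sigma> \<tau> lam z0
          (zs (k - 1)) (\<eta>s (k - 1)) (ls k) (zs k) (zts k) (es k) (\<eta>s k) \<and>
        (stop_test p \<rho> \<epsilon> (step_residual w (ls k) (zs (k - 1)) (zs k)) (es k)
           \<longleftrightarrow> K = enat k))"

section \<open>Basic facts\<close>

lemma grad_eqI:
  assumes "GDERIV (\<lambda>x. real_of_ereal (w x)) z :> g"
  shows "grad w z = g"
  unfolding grad_def
proof (rule the_equality)
  fix h assume "GDERIV (\<lambda>x. real_of_ereal (w x)) z :> h"
  then have "(\<lambda>y. y \<bullet> h) = (\<lambda>y. y \<bullet> g)"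
    using assms unfolding gderiv_def by (rule has_derivative_unique)
  then have "(h - g) \<bullet> h = (h - g) \<bullet> g" by metis
  then have "(h - g) \<bullet> (h - g) = 0" by (simp add: inner_diff_right)
  then show "h = g" by simp
qed (rule assms)

lemma dist_gen_fun_finite:
  assumes "dist_gen_fun w" and "z \<in> eff_dom w"
  shows "\<bar>w z\<bar> \<noteq> \<infinity>"
  using assms by (auto simp: dist_gen_fun_def proper_fun_def eff_dom_def)

lemma bregman_finite:
  assumes "dist_gen_fun w" and "z \<in> eff_dom w" and "z' \<in> eff_dom w"
  shows "bregman w z z' =
    ereal (real_of_ereal (w z') - real_of_ereal (w z) - grad w z \<bullet> (z' - z))"
  using dist_gen_fun_finite[OF assms(1,2)] dist_gen_fun_finite[OF assms(1,3)]
  unfolding bregman_def by (cases "w z"; cases "w z'") auto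

lemma grad_bregman:
  assumes w: "dist_gen_fun w"
    and z: "z \<in> interior (eff_dom w)" and z': "z' \<in> interior (eff_dom w)"
  shows "grad (bregman w z) z' = grad w z' - grad w z"
proof (rule grad_eqI)
  obtain g where g: "GDERIV (\<lambda>x. real_of_ereal (w x)) z' :> g"
    using w z' unfolding dist_gen_fun_def by blast
  have gg: "grad w z' = g" by (rule grad_eqI[OF g])
  let ?f = "\<lambda>x. real_of_ereal (w x) - real_of_ereal (w z) - grad w z \<bullet> (x - z)"
  have "(?f has_derivative (\<lambda>h. h \<bullet> (grad w z' - grad w z))) (at z')"
    using g unfolding gderiv_def gg
    by (auto intro!: derivative_eq_intros simp: inner_diff_right inner_commute)
  moreover have "?f x = real_of_ereal (bregman w z x)" if "x \<in> interior (eff_dom w)" for x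
    using bregman_finite[OF w] z that interior_subset[of "eff_dom w"] by (simp add: subset_iff)
  ultimately show "GDERIV (\<lambda>x. real_of_ereal (bregman w z x)) z' :> grad w z' - grad w z"
    unfolding gderiv_def
    by (rule has_derivative_transform_within_open[OF _ open_interior z'])
qed

lemma INF_bregman_finite:
  assumes "dist_gen_fun w" and "regular_wrt m M w Z p" and "0 < m"
    and "Z \<subseteq> interior (eff_dom w)" and "z0 \<in> Z" and "S \<subseteq> Z" and "S \<noteq> {}"
  shows "\<bar>INF z\<in>S. bregman w z0 z\<bar> \<noteq> \<infinity>"
proof -
  have Z: "Z \<subseteq> eff_dom w" using assms(4) interior_subset by blast
  obtain s where s: "s \<in> S" using assms(7) by blast
  have "0 \<le> bregman w z0 z" if "z \<in> S" for z
  proof -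
    have "0 \<le> ereal (m / 2 * (p (z0 - z))\<^sup>2)" using assms(3) by simp
    also have "\<dots> \<le> bregman w z0 z"
      using assms(2,5,6) that unfolding regular_wrt_def by blast
    finally show ?thesis .
  qed
  then have "0 \<le> (INF z\<in>S. bregman w z0 z)" by (rule INF_greatest)
  moreover have "(INF z\<in>S. bregman w z0 z) \<le> bregman w z0 s" using s by (rule INF_lower)
  moreover have "bregman w z0 s < \<infinity>"
  proof -
    have "z0 \<in> eff_dom w" "s \<in> eff_dom w" using Z s assms(5,6) by auto
    then show ?thesis by (simp add: bregman_finite[OF assms(1)])
  qed
  ultimately show ?thesis by auto
qed

end

theory Submission
  imports Defs
begin

text \<open>
  Write \<open>V a b\<close> for the Bregman distance from \<open>a\<close> to \<open>b\<close>, and let \<open>s\<close> solve the regularized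
  inclusion \<open>0 \<in> T s + \<mu> (\<nabla>w s - \<nabla>w z0)\<close>. Monotonicity of \<open>T\<close> gives \<open>V z0 s \<le> d0\<close>. Testing the
  enlargement inclusion of an iteration \<open>(y, \<eta>') \<mapsto> (x, \<eta>)\<close> with predictor \<open>xt\<close> and stepsize \<open>l\<close>
  against \<open>s\<close>, the potential \<open>\<Delta> = V x s + \<eta>\<close> drops by at least
  \<open>(1 - \<sigma>) V y xt + l \<mu> (V s xt + V xt s) + \<tau> \<eta>'\<close>. By regularity this is at least a fixed fraction
  of the previous potential, so \<open>\<Delta>\<close> decays geometrically; the previous potential also bounds
  the residual and \<open>\<epsilon>\<close> of the iteration, whence the iteration count.
\<close>

section \<open>Seminorms and their dual bounds\<close>

lemma is_seminorm_scaleR: "is_seminorm p \<Longrightarrow> p (c *\<^sub>R x) = \<bar>c\<bar> * p x"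
  by (simp add: is_seminorm_def)

lemma is_seminorm_zero: "is_seminorm p \<Longrightarrow> p 0 = 0"
  using is_seminorm_scaleR[of p 0 0] by simp

lemma is_seminorm_uminus: "is_seminorm p \<Longrightarrow> p (- x) = p x"
  using is_seminorm_scaleR[of p "- 1" x] by simp

lemma is_seminorm_nonneg:
  assumes "is_seminorm p" shows "0 \<le> p x"
proof -
  have "p (x + - x) \<le> p x + p (- x)"
    using assms unfolding is_seminorm_def by blast
  then show ?thesis by (simp add: is_seminorm_zero is_seminorm_uminus assms)
qed

lemma is_seminorm_minus_commute: "is_seminorm p \<Longrightarrow> p (x - y) = p (y - x)"
  using is_seminorm_uminus[of p "x - y"] by simp

lemma is_seminorm_triangle_mid:
  assumes "is_seminorm p" shows "p (x - z) \<le> p (x - y) + p (y - z)"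
proof -
  have "p ((x - y) + (y - z)) \<le> p (x - y) + p (y - z)"
    using assms unfolding is_seminorm_def by blast
  then show ?thesis by simp
qed

text \<open>Trades the extended-real supremum for real inequalities that can be used pointwise. Off
  the kernel of \<open>p\<close> this is normalization; on the kernel a finite bound forces
  \<open>u\<close> to vanish, since kernel vectors can be scaled freely within the unit
  ball.\<close>

lemma dual_seminorm_le_iff:
  assumes p: "is_seminorm p" and c: "0 \<le> c"
  shows "dual_seminorm p u \<le> ereal c \<longleftrightarrow> (\<forall>v. u \<bullet> v \<le> c * p v)"
proof
  assume "dual_seminorm p u \<le> ereal c"
  then have le: "u \<bullet> v \<le> c" if "p v \<le> 1" for v
    using that by (simp add: dual_seminorm_def SUP_le_iff)
  show "\<forall>v. u \<bullet> v \<le> c * p v"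
  proof
    fix v
    show "u \<bullet> v \<le> c * p v"
    proof (cases "p v = 0")
      case True
      have "u \<bullet> v \<le> 0"
      proof (rule ccontr)
        assume pos: "\<not> u \<bullet> v \<le> 0"
        \<comment> \<open>The scaled vector still has seminorm 0, but its inner product with
          \<open>u\<close> is \<open>c + 1\<close>.\<close>
        have "u \<bullet> (((c + 1) / (u \<bullet> v)) *\<^sub>R v) \<le> c"
          by (rule le) (simp add: is_seminorm_scaleR[OF p] True)
        with pos show False by simp
      qed
      with True show ?thesis by simp
    next
      case False
      then have pos: "0 < p v" using is_seminorm_nonneg[OF p, of v] by simp
      have "u \<bullet> ((1 / p v) *\<^sub>R v) \<le> c"
        by (rule le) (use pos in \<open>simp add: is_seminorm_scaleR[OF p]\<close>)
      with pos show ?thesis by (simp add: field_simps)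
    qed
  qed
next
  assume *: "\<forall>v. u \<bullet> v \<le> c * p v"
  have "u \<bullet> v \<le> c" if "p v \<le> 1" for v
    using *[rule_format, of v] mult_left_mono[OF that c] by simp
  then show "dual_seminorm p u \<le> ereal c"
    by (simp add: dual_seminorm_def SUP_le_iff)
qed

lemma dual_seminorm_scaleR_le:
  assumes "is_seminorm p" "0 \<le> c" "0 \<le> a" "dual_seminorm p u \<le> ereal c"
  shows "dual_seminorm p (a *\<^sub>R u) \<le> ereal (a * c)"
  using assms by (auto simp: dual_seminorm_le_iff mult.assoc intro!: mult_left_mono)

lemma dual_seminorm_diff_le:
  assumes p: "is_seminorm p" and "0 \<le> c" "0 \<le> d"
    and u: "dual_seminorm p u \<le> ereal c" and v: "dual_seminorm p v \<le> ereal d"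
  shows "dual_seminorm p (u - v) \<le> ereal (c + d)"
proof -
  have "(u - v) \<bullet> x \<le> (c + d) * p x" for x
  proof -
    have "u \<bullet> x \<le> c * p x" using u assms by (simp add: dual_seminorm_le_iff)
    moreover have "\<forall>y. v \<bullet> y \<le> d * p y" using v assms by (simp add: dual_seminorm_le_iff)
    then have "v \<bullet> (- x) \<le> d * p (- x)" by blast
    ultimately show ?thesis by (simp add: inner_diff_left algebra_simps is_seminorm_uminus[OF p])
  qed
  then show ?thesis using assms by (simp add: dual_seminorm_le_iff)
qed

section \<open>Two inequalities for real numbers\<close>

lemma square_sum_le_weighted:
  fixes a b :: real
  assumes "0 < a" "0 < b"
  shows "(x + y)\<^sup>2 \<le> (1 / a + 1 / b) * (a * x\<^sup>2 + b * y\<^sup>2)"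
proof -
  have "(1 / a + 1 / b) * (a * x\<^sup>2 + b * y\<^sup>2) - (x + y)\<^sup>2 = (a * x - b * y)\<^sup>2 / (a * b)"
    using assms by (simp add: field_simps power2_eq_square)
  also have "\<dots> \<ge> 0" using assms by simp
  finally show ?thesis by simp
qed

text \<open>Rests on \<open>1 - d \<le> exp (- d)\<close>. It turns a contraction factor into an
  iteration count: \<open>log_plus t / d\<close> contractions absorb an initial factor
  \<open>t\<close>, and none are needed when \<open>t\<close> is at most 1.\<close>

lemma geometric_decay_le_one:
  fixes t d :: real
  assumes t: "0 \<le> t" and d: "0 < d" "d \<le> 1" and n: "log_plus t / d \<le> real n"
  shows "(1 - d) ^ n * t \<le> 1"
proof (cases "t \<le> 1")
  case True
  have "(1 - d) ^ n \<le> 1" using d by (simp add: power_le_one)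
  with True t show ?thesis using mult_mono[of "(1 - d) ^ n" 1 t 1] by simp
next
  case False
  then have "ln t \<le> real n * d"
    using n d by (simp add: log_plus_def field_simps split: if_splits)
  then have "t \<le> exp (real n * d)" using False by (metis exp_le_cancel_iff exp_ln linorder_not_le less_trans zero_less_one)
  moreover have "(1 - d) ^ n \<le> exp (- d) ^ n"
    using d exp_ge_add_one_self[of "- d"] by (intro power_mono) auto
  ultimately have "(1 - d) ^ n * t \<le> exp (- d) ^ n * exp (real n * d)"
    using d t by (intro mult_mono) auto
  also have "\<dots> = 1" by (simp add: exp_of_nat_mult[symmetric] exp_add[symmetric])
  finally show ?thesis .
qed

section \<open>Bregman distances under regularity\<close>

locale regular_bregman =
  fixes w :: "'a::real_inner \<Rightarrow> ereal" and Z :: "'a set" and p :: "'a \<Rightarrow> real" and m M :: real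
  assumes dgf: "dist_gen_fun w"
    and convex_Z: "convex Z" and Z_interior: "Z \<subseteq> interior (eff_dom w)"
    and seminorm: "is_seminorm p"
    and m_pos: "0 < m" and M_pos: "0 < M" and regular: "regular_wrt m M w Z p"
begin

text \<open>A real-valued stand-in for \<open>bregman\<close>, open to linear arithmetic; the two
  agree on \<open>Z\<close>, where \<open>w\<close> is finite.\<close>

definition V :: "'a \<Rightarrow> 'a \<Rightarrow> real" where
  "V a b = real_of_ereal (w b) - real_of_ereal (w a) - grad w a \<bullet> (b - a)"

lemma bregman_eq_V: "a \<in> Z \<Longrightarrow> b \<in> Z \<Longrightarrow> bregman w a b = ereal (V a b)"
  unfolding V_def using bregman_finite[OF dgf] Z_interior interior_subset by blast

lemma grad_bregman_Z: "a \<in> Z \<Longrightarrow> b \<in> Z \<Longrightarrow> grad (bregman w a) b = grad w b - grad w a"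
  using grad_bregman[OF dgf] Z_interior by blast

lemma V_lower: "a \<in> Z \<Longrightarrow> b \<in> Z \<Longrightarrow> m / 2 * (p (a - b))\<^sup>2 \<le> V a b"
  using regular bregman_eq_V unfolding regular_wrt_def by (metis ereal_less_eq(3))

lemma V_nonneg: "a \<in> Z \<Longrightarrow> b \<in> Z \<Longrightarrow> 0 \<le> V a b"
  using V_lower[of a b] m_pos by (smt (verit) mult_nonneg_nonneg zero_le_power2 divide_pos_pos)

lemma seminorm_diff_le:
  assumes "a \<in> Z" "b \<in> Z" shows "p (a - b) \<le> sqrt (2 / m) * sqrt (V a b)"
proof -
  have "(p (a - b))\<^sup>2 \<le> 2 / m * V a b"
    using V_lower[OF assms] m_pos by (simp add: field_simps)
  then show ?thesis by (simp add: real_le_rsqrt flip: real_sqrt_mult)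
qed

lemma dual_grad_diff_le:
  "a \<in> Z \<Longrightarrow> b \<in> Z \<Longrightarrow> dual_seminorm p (grad w a - grad w b) \<le> ereal (M * p (a - b))"
  using regular unfolding regular_wrt_def by blast

lemma grad_diff_inner_le:
  "a \<in> Z \<Longrightarrow> b \<in> Z \<Longrightarrow> (grad w a - grad w b) \<bullet> v \<le> M * p (a - b) * p v"
  using dual_grad_diff_le dual_seminorm_le_iff[OF seminorm] is_seminorm_nonneg[OF seminorm] M_pos
  by simp

text \<open>The descent lemma: the Lipschitz bound on the gradient is integrated along the segment
  from \<open>a\<close> to \<open>b\<close>, which stays in \<open>Z\<close> by convexity.
  Integration is replaced by monotonicity of an auxiliary function.\<close>

lemma V_upper:
  assumes a: "a \<in> Z" and b: "b \<in> Z" shows "V a b \<le> M / 2 * (p (a - b))\<^sup>2"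
proof -
  define c where "c t = a + t *\<^sub>R (b - a)" for t :: real
  \<comment> \<open>Chosen so that \<open>f 1 - f 0\<close> is exactly \<open>V a b\<close> minus
    the claimed bound, while the Lipschitz bound makes the derivative nonpositive on the unit
    interval.\<close>
  define f where "f t = real_of_ereal (w (c t)) - t * (grad w a \<bullet> (b - a)) - M / 2 * t\<^sup>2 * (p (b - a))\<^sup>2"
    for t
  have cZ: "c t \<in> Z" if "0 \<le> t" "t \<le> 1" for t
  proof -
    have "(1 - t) *\<^sub>R a + t *\<^sub>R b \<in> Z" using convexD_alt[OF convex_Z a b that] .
    moreover have "(1 - t) *\<^sub>R a + t *\<^sub>R b = c t" by (simp add: c_def algebra_simps)
    ultimately show ?thesis by simp
  qed
  have "f 1 \<le> f 0"
  proof (rule DERIV_nonpos_imp_nonincreasing[of 0 1 f])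
    fix t :: real assume t: "0 \<le> t" "t \<le> 1"
    obtain g where "GDERIV (\<lambda>x. real_of_ereal (w x)) (c t) :> g"
      using dgf cZ[OF t] Z_interior unfolding dist_gen_fun_def by blast
    then have gd: "((\<lambda>x. real_of_ereal (w x)) has_derivative (\<lambda>h. h \<bullet> grad w (c t))) (at (c t))"
      using grad_eqI unfolding gderiv_def by blast
    have cd: "(c has_derivative (\<lambda>h. h *\<^sub>R (b - a))) (at t)"
      unfolding c_def by (auto intro!: derivative_eq_intros)
    have "((\<lambda>t. real_of_ereal (w (c t))) has_derivative (\<lambda>h. (h *\<^sub>R (b - a)) \<bullet> grad w (c t))) (at t)"
      by (rule has_derivative_compose[OF cd gd])
    then have "((\<lambda>t. real_of_ereal (w (c t))) has_real_derivative (b - a) \<bullet> grad w (c t)) (at t)"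
      by (rule has_derivative_imp_has_field_derivative) (simp add: mult.commute)
    then have "(f has_real_derivative
        ((b - a) \<bullet> grad w (c t) - grad w a \<bullet> (b - a) - M * t * (p (b - a))\<^sup>2)) (at t)"
      unfolding f_def by (auto intro!: derivative_eq_intros)
    moreover have "(b - a) \<bullet> grad w (c t) - grad w a \<bullet> (b - a) - M * t * (p (b - a))\<^sup>2 \<le> 0"
    proof -
      have "p (c t - a) = t * p (b - a)"
        using t by (simp add: c_def is_seminorm_scaleR[OF seminorm])
      then have "(grad w (c t) - grad w a) \<bullet> (b - a) \<le> M * (t * p (b - a)) * p (b - a)"
        using grad_diff_inner_le[OF cZ[OF t] a, of "b - a"] by simp
      then show ?thesis by (simp add: inner_diff inner_commute power2_eq_square algebra_simps)
    qed
    ultimately show "\<exists>y. (f has_real_derivative y) (at t) \<and> y \<le> 0" by blast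
  qed simp
  then show ?thesis
    by (simp add: f_def c_def V_def is_seminorm_minus_commute[OF seminorm, of b a])
qed

section \<open>Estimates for a single iteration\<close>

text \<open>An iteration turns the state \<open>(y, \<eta>')\<close> into \<open>(x, \<eta>)\<close>; \<open>s\<close> solves the regularized inclusion.\<close>

context
  fixes T :: "'a \<Rightarrow> 'a set" and \<mu> \<sigma> \<tau> lam :: real and z0 s y x xt :: 'a and \<eta>' l e \<eta> :: real
  assumes \<mu>_pos: "0 < \<mu>" and \<sigma>_nonneg: "0 \<le> \<sigma>" and \<sigma>_less: "\<sigma> < 1" and \<tau>_pos: "0 < \<tau>"
    and \<tau>_less: "\<tau> < 1" and lam_pos: "0 < lam"
    and z0: "z0 \<in> Z" and y: "y \<in> Z" and s: "s \<in> Z"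
    and s_sol: "- \<mu> *\<^sub>R (grad w s - grad w z0) \<in> T s"
    and \<eta>'_nonneg: "0 \<le> \<eta>'"
    and step: "admissible_step w T Z \<mu> \<sigma> \<tau> lam z0 y \<eta>' l x xt e \<eta>"
begin

lemma step_facts:
  shows "lam \<le> l" and "0 < l" and "x \<in> Z" and "xt \<in> Z" and "0 \<le> e" and "0 \<le> \<eta>"
  using step lam_pos by (auto simp: admissible_step_def)

lemma step_error: "V x xt + l * e + \<eta> \<le> \<sigma> * V y xt + (1 - \<tau>) * \<eta>'"
proof -
  have "ereal (V x xt) + ereal (l * e + \<eta>) \<le> ereal \<sigma> * ereal (V y xt) + ereal ((1 - \<tau>) * \<eta>')"
    using step y step_facts by (simp add: admissible_step_def bregman_eq_V)
  then show ?thesis by (simp add: add.assoc)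
qed

lemma step_residual_eq: "step_residual w l y x = (1 / l) *\<^sub>R (grad w y - grad w x)"
  using y step_facts by (simp add: step_residual_def grad_bregman_Z)

text \<open>The enlargement inequality at \<open>s\<close>, multiplied by \<open>l\<close>, bounds
  the inner product of \<open>grad w y - grad w x\<close> with \<open>xt - s\<close> from below.
  Expressing that product by Bregman distances and adding the error criterion
  \<open>step_error\<close> gives the claim.\<close>

lemma potential_decrease:
  "V x s + \<eta> + (1 - \<sigma>) * V y xt + l * \<mu> * (V s xt + V xt s) \<le> V y s + (1 - \<tau>) * \<eta>'"
proof -
  obtain v where v: "v \<in> enlargement T e xt"
    and r: "step_residual w l y x = \<mu> *\<^sub>R (grad w xt - grad w z0) + v"
    using step z0 step_facts by (auto simp: admissible_step_def grad_bregman_Z)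
  have "- e \<le> (v - (- \<mu> *\<^sub>R (grad w s - grad w z0))) \<bullet> (xt - s)"
    using v s_sol unfolding enlargement_def by blast
  \<comment> \<open>Both inclusions are regularized at the same base point, so
    \<open>grad w z0\<close> cancels.\<close>
  also have "v - (- \<mu> *\<^sub>R (grad w s - grad w z0))
      = (1 / l) *\<^sub>R (grad w y - grad w x) - \<mu> *\<^sub>R (grad w xt - grad w s)"
    using r unfolding step_residual_eq by (simp add: algebra_simps)
  \<comment> \<open>The symmetrized distance \<open>V s xt + V xt s\<close> is the inner product of
    \<open>grad w xt - grad w s\<close> with \<open>xt - s\<close>.\<close>
  also have "\<dots> \<bullet> (xt - s) = (grad w y - grad w x) \<bullet> (xt - s) / l - \<mu> * (V s xt + V xt s)"
    by (simp add: V_def inner_diff_left inner_diff_right algebra_simps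
        add_divide_distrib diff_divide_distrib)
  finally have "l * - e \<le> l * ((grad w y - grad w x) \<bullet> (xt - s) / l - \<mu> * (V s xt + V xt s))"
    using step_facts(2) by (intro mult_left_mono) auto
  also have "\<dots> = (grad w y - grad w x) \<bullet> (xt - s) - l * \<mu> * (V s xt + V xt s)"
    using step_facts(2) by (simp add: right_diff_distrib)
  \<comment> \<open>Four-point identity: all values of \<open>w\<close> cancel and only the gradient
    terms remain.\<close>
  also have "(grad w y - grad w x) \<bullet> (xt - s) = (V y s - V x s) - (V y xt - V x xt)"
    by (simp add: V_def inner_diff_left inner_diff_right)
  finally show ?thesis using step_error by (simp add: left_diff_distrib)
qed

lemma V_predictor_le: "(1 - \<sigma>) * V y xt \<le> V y s + \<eta>'"
proof -
  have "0 \<le> l * \<mu> * (V s xt + V xt s)"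
    using step_facts s \<mu>_pos by (intro mult_nonneg_nonneg add_nonneg_nonneg V_nonneg) auto
  moreover have "0 \<le> V x s" "0 \<le> \<tau> * \<eta>'" using step_facts s \<tau>_pos \<eta>'_nonneg by (auto intro: V_nonneg)
  ultimately show ?thesis
    using potential_decrease step_facts(6) by (simp add: left_diff_distrib)
qed

text \<open>By \<open>V_upper\<close> it suffices to control \<open>p (y - s)\<close>, and the
  triangle inequality goes through \<open>xt\<close>: the leg from \<open>y\<close> is paid by the
  first term of the decrease, the leg to \<open>s\<close> by the symmetrized term. The weighted
  square inequality combines the two.\<close>

lemma V_le_decrease:
  "V y s \<le> M / m * (1 / (lam * \<mu>) + 1 / (1 - \<sigma>)) * ((1 - \<sigma>) * V y xt + l * \<mu> * (V s xt + V xt s))"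
proof -
  \<comment> \<open>The weights are the strong convexity constants of the two terms. The second has
    no factor 1/2 because the lower bound is used for both orders of \<open>s\<close> and
    \<open>xt\<close>.\<close>
  let ?a = "(1 - \<sigma>) * m / 2" and ?b = "lam * \<mu> * m"
  let ?R = "(1 - \<sigma>) * V y xt + l * \<mu> * (V s xt + V xt s)"
  have ab: "0 < ?a" "0 < ?b" using \<sigma>_less m_pos lam_pos \<mu>_pos by auto
  have Vs: "0 \<le> V y xt" "0 \<le> V s xt" "0 \<le> V xt s" using y s step_facts by (auto intro: V_nonneg)
  then have R: "0 \<le> ?R" using \<sigma>_less \<mu>_pos step_facts by auto
  have 1: "?a * (p (y - xt))\<^sup>2 \<le> (1 - \<sigma>) * V y xt"
    using mult_left_mono[OF V_lower[OF y step_facts(4)], of "1 - \<sigma>"] \<sigma>_less by (simp add: mult.assoc)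
  have "m * (p (xt - s))\<^sup>2 \<le> V s xt + V xt s"
    using V_lower[OF s step_facts(4)] V_lower[OF step_facts(4) s]
    by (simp add: is_seminorm_minus_commute[OF seminorm, of s xt])
  then have "lam * \<mu> * (m * (p (xt - s))\<^sup>2) \<le> l * \<mu> * (V s xt + V xt s)"
    using step_facts lam_pos \<mu>_pos m_pos by (intro mult_mono) auto
  then have 2: "?b * (p (xt - s))\<^sup>2 \<le> l * \<mu> * (V s xt + V xt s)" by (simp add: mult.assoc)
  have "(p (y - s))\<^sup>2 \<le> (p (y - xt) + p (xt - s))\<^sup>2"
    using is_seminorm_triangle_mid[OF seminorm] is_seminorm_nonneg[OF seminorm] by (intro power_mono)
  also have "\<dots> \<le> (1 / ?a + 1 / ?b) * (?a * (p (y - xt))\<^sup>2 + ?b * (p (xt - s))\<^sup>2)"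
    by (rule square_sum_le_weighted[OF ab])
  also have "\<dots> \<le> (1 / ?a + 1 / ?b) * ?R"
    using 1 2 ab by (intro mult_left_mono add_mono) auto
  \<comment> \<open>Weakened from 1 to 2 in the second term so that the constant becomes the one in
    the iteration bound.\<close>
  also have "\<dots> \<le> (1 / ?a + 2 / ?b) * ?R"
    using ab R by (intro mult_right_mono) (auto simp: field_simps)
  finally have "M / 2 * (p (y - s))\<^sup>2 \<le> M / 2 * ((1 / ?a + 2 / ?b) * ?R)"
    using M_pos by (intro mult_left_mono) auto
  also have "\<dots> = (M / 2 * (1 / ?a + 2 / ?b)) * ?R" by simp
  also have "M / 2 * (1 / ?a + 2 / ?b) = M / m * (1 / (lam * \<mu>) + 1 / (1 - \<sigma>))"
    using \<sigma>_less m_pos lam_pos \<mu>_pos by (simp add: field_simps)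
  finally show ?thesis using V_upper[OF y s] by (rule order_trans[rotated])
qed

text \<open>The two lower bounds on \<open>\<kappa>\<close> serve the two summands of the potential:
  the first makes the Bregman decrease at least \<open>V y s / \<kappa>\<close>, the second makes
  \<open>\<tau> * \<eta>'\<close> at least \<open>\<eta>' / \<kappa>\<close>.\<close>

lemma potential_contraction:
  assumes \<kappa>: "M / m * (1 / (lam * \<mu>) + 1 / (1 - \<sigma>)) \<le> \<kappa>" "1 / \<tau> \<le> \<kappa>"
  shows "V x s + \<eta> \<le> (1 - 1 / \<kappa>) * (V y s + \<eta>')"
proof -
  let ?R = "(1 - \<sigma>) * V y xt + l * \<mu> * (V s xt + V xt s)"
  have "0 < 1 / \<tau>" using \<tau>_pos by simp
  then have \<kappa>0: "0 < \<kappa>" using \<kappa>(2) by linarith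
  have Vs: "0 \<le> V y xt" "0 \<le> V s xt" "0 \<le> V xt s" using y s step_facts by (auto intro: V_nonneg)
  then have R: "0 \<le> ?R" using \<sigma>_less \<mu>_pos step_facts by auto
  have "V y s \<le> \<kappa> * ?R" using V_le_decrease mult_right_mono[OF \<kappa>(1) R] by linarith
  then have 1: "V y s / \<kappa> \<le> ?R" using \<kappa>0 by (simp add: field_simps)
  have "1 / \<kappa> \<le> \<tau>" using \<kappa>(2) \<kappa>0 \<tau>_pos by (simp add: field_simps)
  then have 2: "\<eta>' / \<kappa> \<le> \<tau> * \<eta>'" using mult_right_mono[OF _ \<eta>'_nonneg, of "1 / \<kappa>" \<tau>] by simp
  show ?thesis using potential_decrease 1 2 by (simp add: algebra_simps add_divide_distrib)
qed

text \<open>The error criterion is multiplied by \<open>1 - \<sigma>\<close> and the bound on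
  \<open>(1 - \<sigma>) * V y xt\<close> from \<open>potential_decrease\<close> is inserted. The
  coefficients of \<open>(1 - \<tau>) * \<eta>'\<close> are then \<open>\<sigma>\<close> and
  \<open>1 - \<sigma>\<close>, with sum 1.\<close>

lemma step_epsilon_le: "e \<le> (V y s + \<eta>') / (lam * (1 - \<sigma>))"
proof -
  have "\<sigma> * ((1 - \<sigma>) * V y xt) \<le> \<sigma> * (V y s + (1 - \<tau>) * \<eta>')"
  proof (intro mult_left_mono \<sigma>_nonneg)
    have "0 \<le> l * \<mu> * (V s xt + V xt s)"
      using step_facts s \<mu>_pos by (intro mult_nonneg_nonneg add_nonneg_nonneg V_nonneg) auto
    moreover have "0 \<le> V x s" using step_facts s by (auto intro: V_nonneg)
    ultimately show "(1 - \<sigma>) * V y xt \<le> V y s + (1 - \<tau>) * \<eta>'"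
      using potential_decrease step_facts(6) by linarith
  qed
  moreover have "l * e \<le> \<sigma> * V y xt + (1 - \<tau>) * \<eta>'"
    using step_error V_nonneg[OF step_facts(3,4)] step_facts(6) by linarith
  then have "(1 - \<sigma>) * (l * e) \<le> (1 - \<sigma>) * (\<sigma> * V y xt + (1 - \<tau>) * \<eta>')"
    using \<sigma>_less by (intro mult_left_mono) auto
  ultimately have "(1 - \<sigma>) * (l * e) \<le> \<sigma> * V y s + (1 - \<tau>) * \<eta>'"
    by (simp add: algebra_simps)
  moreover have "\<sigma> * V y s \<le> V y s" using V_nonneg[OF y s] \<sigma>_less \<sigma>_nonneg by (simp add: mult_left_le_one_le)
  moreover have "(1 - \<tau>) * \<eta>' \<le> \<eta>'" using \<eta>'_nonneg \<tau>_pos \<tau>_less by (simp add: mult_left_le_one_le)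
  moreover have "(1 - \<sigma>) * (lam * e) \<le> (1 - \<sigma>) * (l * e)"
    using step_facts \<sigma>_less by (intro mult_left_mono mult_right_mono) auto
  ultimately have "(1 - \<sigma>) * (lam * e) \<le> V y s + \<eta>'" by linarith
  then show ?thesis using \<sigma>_less lam_pos by (simp add: field_simps)
qed

text \<open>Both iterates are close to \<open>s\<close>: each of \<open>p (y - s)\<close> and
  \<open>p (x - s)\<close> is bounded through the previous potential, whence the factor 2. The
  Lipschitz bound on the gradient and \<open>lam \<le> l\<close> do the rest.\<close>

lemma step_residual_dual_le:
  assumes "V x s \<le> V y s + \<eta>'"
  shows "dual_seminorm p (step_residual w l y x) \<le> ereal (2 * sqrt 2 * M / (lam * sqrt m) * sqrt (V y s + \<eta>'))"
proof -
  let ?q = "sqrt (2 / m) * sqrt (V y s + \<eta>')"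
  have "p (y - x) \<le> p (y - s) + p (s - x)" by (rule is_seminorm_triangle_mid[OF seminorm])
  also have "p (s - x) = p (x - s)" by (rule is_seminorm_minus_commute[OF seminorm])
  also have "p (y - s) \<le> sqrt (2 / m) * sqrt (V y s)" by (rule seminorm_diff_le[OF y s])
  also have "\<dots> \<le> ?q" using \<eta>'_nonneg m_pos by (intro mult_left_mono) auto
  also have "p (x - s) \<le> sqrt (2 / m) * sqrt (V x s)" by (rule seminorm_diff_le[OF step_facts(3) s])
  also have "\<dots> \<le> ?q" using assms m_pos by (intro mult_left_mono) auto
  finally have "M * p (y - x) \<le> M * (2 * ?q)" using M_pos by simp
  moreover have "dual_seminorm p (grad w y - grad w x) \<le> ereal (M * p (y - x))"
    by (rule dual_grad_diff_le[OF y step_facts(3)])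
  ultimately have "dual_seminorm p (grad w y - grad w x) \<le> ereal (M * (2 * ?q))"
    by (meson ereal_less_eq(3) order_trans)
  moreover have q: "0 \<le> ?q" using V_nonneg[OF y s] \<eta>'_nonneg m_pos by simp
  ultimately have "dual_seminorm p (step_residual w l y x) \<le> ereal (1 / l * (M * (2 * ?q)))"
    unfolding step_residual_eq using M_pos step_facts by (intro dual_seminorm_scaleR_le[OF seminorm]) auto
  moreover have "1 / l * (M * (2 * ?q)) \<le> 1 / lam * (M * (2 * ?q))"
    using q M_pos step_facts lam_pos by (intro mult_right_mono) (auto simp: field_simps)
  moreover have "1 / lam * (M * (2 * ?q)) = 2 * sqrt 2 * M / (lam * sqrt m) * sqrt (V y s + \<eta>')"
    by (simp add: real_sqrt_divide)
  ultimately show ?thesis by (metis ereal_less_eq(3) order_trans)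
qed

text \<open>The path from \<open>xt\<close> to \<open>z0\<close> goes through \<open>y\<close> and
  \<open>s\<close>. The first leg costs \<open>1 / sqrt (1 - \<sigma>)\<close> by
  \<open>V_predictor_le\<close>, the other two cost 1 each, which explains the constant.\<close>

lemma predictor_dual_le:
  assumes d: "V y s + \<eta>' \<le> d" "V z0 s \<le> d"
  shows "dual_seminorm p (grad (bregman w z0) xt)
    \<le> ereal (sqrt 2 * M / sqrt m * (2 + 1 / sqrt (1 - \<sigma>)) * sqrt d)"
proof -
  have "V y xt \<le> d / (1 - \<sigma>)" using V_predictor_le d \<sigma>_less by (simp add: field_simps)
  then have "sqrt (V y xt) \<le> sqrt d / sqrt (1 - \<sigma>)" by (simp flip: real_sqrt_divide)
  moreover have "sqrt (V y s) \<le> sqrt d" "sqrt (V z0 s) \<le> sqrt d" using d \<eta>'_nonneg by auto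
  moreover have "(2 + 1 / sqrt (1 - \<sigma>)) * sqrt d = 2 * sqrt d + sqrt d / sqrt (1 - \<sigma>)"
    by (simp add: distrib_right)
  ultimately have sq: "sqrt (V y xt) + sqrt (V y s) + sqrt (V z0 s) \<le> (2 + 1 / sqrt (1 - \<sigma>)) * sqrt d"
    by linarith
  have "p (xt - z0) \<le> p (xt - y) + (p (y - s) + p (s - z0))"
    using is_seminorm_triangle_mid[OF seminorm, of xt z0 y] is_seminorm_triangle_mid[OF seminorm, of y z0 s]
    by linarith
  also have "\<dots> = p (y - xt) + p (y - s) + p (z0 - s)"
    by (simp add: is_seminorm_minus_commute[OF seminorm, of xt y] is_seminorm_minus_commute[OF seminorm, of s z0])
  also have "\<dots> \<le> sqrt (2 / m) * (sqrt (V y xt) + sqrt (V y s) + sqrt (V z0 s))"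
    using seminorm_diff_le[OF y step_facts(4)] seminorm_diff_le[OF y s] seminorm_diff_le[OF z0 s]
    by (simp add: distrib_left)
  also have "\<dots> \<le> sqrt (2 / m) * ((2 + 1 / sqrt (1 - \<sigma>)) * sqrt d)"
    using sq m_pos by (intro mult_left_mono) auto
  finally have "M * p (xt - z0) \<le> M * (sqrt (2 / m) * ((2 + 1 / sqrt (1 - \<sigma>)) * sqrt d))"
    using M_pos by simp
  also have "\<dots> = sqrt 2 * M / sqrt m * (2 + 1 / sqrt (1 - \<sigma>)) * sqrt d"
    by (simp add: real_sqrt_divide)
  finally show ?thesis
    using dual_grad_diff_le[OF step_facts(4) z0]
    by (simp add: grad_bregman_Z[OF z0 step_facts(4)]) (meson ereal_less_eq(3) order_trans)
qed

end

text \<open>Three-point identity: \<open>V z0 x\<close> exceeds \<open>V z0 s\<close> by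
  \<open>V s x\<close> and an inner product, which monotonicity of \<open>T\<close> between
  \<open>s\<close> and the zero \<open>x\<close> makes nonnegative.\<close>

lemma V_regularized_solution_le:
  assumes T: "monotone_op T" and \<mu>: "0 < \<mu>" and in_Z: "z0 \<in> Z" "s \<in> Z" "x \<in> Z"
    and s: "- \<mu> *\<^sub>R (grad w s - grad w z0) \<in> T s" and x: "0 \<in> T x"
  shows "V z0 s \<le> V z0 x"
proof -
  have "0 \<le> (- \<mu> *\<^sub>R (grad w s - grad w z0) - 0) \<bullet> (s - x)"
    using T s x unfolding monotone_op_def by blast
  also have "\<dots> = \<mu> * ((grad w s - grad w z0) \<bullet> (x - s))"
    by (simp add: inner_diff_right algebra_simps)
  finally have "0 \<le> (grad w s - grad w z0) \<bullet> (x - s)" using \<mu> by (simp add: zero_le_mult_iff)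
  moreover have "V z0 x = V z0 s + V s x + (grad w s - grad w z0) \<bullet> (x - s)"
    by (simp add: V_def inner_diff_left inner_diff_right)
  ultimately show ?thesis using V_nonneg[of s x] in_Z by simp
qed

end

section \<open>Iteration count and properties of the output\<close>

theorem theorem3p2:
  fixes w :: "'a::real_inner \<Rightarrow> ereal"
    and T :: "'a \<Rightarrow> 'a set"
    and Z :: "'a set"
    and p :: "'a \<Rightarrow> real"
    and m M \<eta>0 D \<sigma> \<tau> lam \<rho> \<epsilon> :: real
    and z0 :: 'a
    and K :: enat
    and ls es \<eta>s :: "nat \<Rightarrow> real"
    and zs zts :: "nat \<Rightarrow> 'a"
    and \<mu> d0 D0 B :: real
  assumes findim: "\<exists>S :: 'a set. finite S \<and> span S = UNIV"
    and T: "maximal_monotone T" "op_zeros T \<noteq> {}" "op_dom T \<subseteq> Z"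
    and w: "dist_gen_fun w"
    and Z: "convex Z" "Z \<subseteq> interior (eff_dom w)"
    and p: "is_seminorm p"
    and reg: "0 < m" "0 < M" "regular_wrt m M w Z p"
    and Zstar: "\<forall>\<nu>>0. {z \<in> Z. 0 \<in> (\<lambda>v. v + \<nu> *\<^sub>R grad (bregman w z0) z) ` T z} \<noteq> {}"
    and input: "z0 \<in> Z" "0 \<le> \<eta>0" "0 < D" "0 \<le> \<sigma>" "\<sigma> < 1" "0 < \<tau>" "\<tau> < 1"
      "0 < lam" "0 < \<rho>" "0 < \<epsilon>"
    and run: "framework_run w T Z p z0 \<eta>0 D \<sigma> \<tau> lam \<rho> \<epsilon> K ls zs zts es \<eta>s"
    and mu: "\<mu> = \<rho> / D"
    and d0: "d0 = real_of_ereal (INF z\<in>op_zeros T. bregman w z0 z)"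
    and B: "B = max (M / m * (D / (lam * \<rho>) + 1 / (1 - \<sigma>))) (1 / \<tau>) *
      (2 + max (log_plus (32 * M\<^sup>2 * (d0 + \<eta>0) / ((lam * \<rho>)\<^sup>2 * m)))
               (log_plus ((d0 + \<eta>0) / (lam * (1 - \<sigma>) * \<epsilon>))))"
    and D0: "D0 = sqrt 2 * M / sqrt m * (2 + 1 / sqrt (1 - \<sigma>)) * sqrt (d0 + \<eta>0)"
  shows "\<exists>n. K = enat n \<and> 1 \<le> n \<and> real n \<le> B \<and>
    (let rt = step_residual w (ls n) (zs (n - 1)) (zs n) - \<mu> *\<^sub>R grad (bregman w z0) (zts n)
     in
       rt \<in> enlargement T (es n) (zts n) \<and>
       dual_seminorm p (rt + \<mu> *\<^sub>R grad (bregman w z0) (zts n)) \<le> ereal (\<rho> / 2) \<and>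
       es n \<le> \<epsilon> \<and>
       (\<forall>k\<in>{1..n}. dual_seminorm p (grad (bregman w z0) (zts k)) \<le> ereal D0) \<and>
       (D \<ge> 2 * D0 \<longrightarrow> dual_seminorm p rt \<le> ereal \<rho>))"
proof -
  interpret regular_bregman w Z p m M
    using w Z p reg by unfold_locales
  have \<mu>: "0 < \<mu>" using input mu by simp
  obtain s where s: "s \<in> Z" and s_sol: "- \<mu> *\<^sub>R (grad w s - grad w z0) \<in> T s"
  proof -
    obtain s v where "s \<in> Z" "v \<in> T s" "0 = v + \<mu> *\<^sub>R grad (bregman w z0) s"
      using Zstar[rule_format, OF \<mu>] by blast
    moreover from this have "v = - \<mu> *\<^sub>R (grad w s - grad w z0)"
      using grad_bregman_Z[OF input(1), of s] by (simp add: eq_neg_iff_add_eq_0)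
    ultimately show thesis using that by blast
  qed
  have zeros: "op_zeros T \<subseteq> Z" using T(3) by (auto simp: op_zeros_def op_dom_def)
  have "ereal (V z0 s) \<le> (INF z\<in>op_zeros T. bregman w z0 z)"
  proof (rule INF_greatest)
    fix z assume "z \<in> op_zeros T"
    then show "ereal (V z0 s) \<le> bregman w z0 z"
      using V_regularized_solution_le[of T \<mu> z0 s z, OF _ \<mu> input(1) s _ s_sol] T(1) zeros
      by (auto simp: maximal_monotone_def op_zeros_def bregman_eq_V[OF input(1)])
  qed
  \<comment> \<open>\<open>real_of_ereal\<close> sends infinite values to 0, so the lower bound on
    the infimum passes to \<open>d0\<close> only once the infimum is known to be finite.\<close>
  moreover have "\<bar>INF z\<in>op_zeros T. bregman w z0 z\<bar> \<noteq> \<infinity>"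
    by (rule INF_bregman_finite[OF w reg(3,1) Z(2) input(1) zeros T(2)])
  ultimately have Vd0: "V z0 s \<le> d0"
    unfolding d0 by (cases "INF z\<in>op_zeros T. bregman w z0 z") auto

  define \<kappa> where "\<kappa> = max (M / m * (D / (lam * \<rho>) + 1 / (1 - \<sigma>))) (1 / \<tau>)"
  have D_eq: "D / (lam * \<rho>) = 1 / (lam * \<mu>)" using input mu by simp
  have \<kappa>: "M / m * (1 / (lam * \<mu>) + 1 / (1 - \<sigma>)) \<le> \<kappa>" "1 / \<tau> \<le> \<kappa>"
    by (simp_all add: \<kappa>_def D_eq)
  have "1 \<le> 1 / \<tau>" using input by simp
  then have \<kappa>1: "1 \<le> \<kappa>" using \<kappa>(2) by linarith
  define \<Delta> where "\<Delta> k = V (zs k) s + \<eta>s k" for k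
  have init: "zs 0 = z0" "\<eta>s 0 = \<eta>0" and K1: "1 \<le> K"
    and stop: "\<And>k. 1 \<le> k \<Longrightarrow> enat k \<le> K \<Longrightarrow>
        stop_test p \<rho> \<epsilon> (step_residual w (ls k) (zs (k - 1)) (zs k)) (es k) \<longleftrightarrow> K = enat k"
    and adm: "\<And>k. enat (Suc k) \<le> K \<Longrightarrow>
        admissible_step w T Z \<mu> \<sigma> \<tau> lam z0 (zs k) (\<eta>s k) (ls (Suc k)) (zs (Suc k)) (zts (Suc k))
          (es (Suc k)) (\<eta>s (Suc k))"
    using run unfolding framework_run_def mu by force+
  have state: "zs k \<in> Z \<and> 0 \<le> \<eta>s k" if "enat k \<le> K" for k
    using that by (cases k) (use init input adm in \<open>auto simp: admissible_step_def\<close>)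
  \<comment> \<open>The fixed premises of the one-step lemmas in order; the placeholder is the
    membership of the current iterate in \<open>Z\<close>.\<close>
  note step_ctx = \<mu> input(4-8) input(1) _ s s_sol
  have prev: "enat k \<le> K" if "enat (Suc k) \<le> K" for k
    using that by (meson enat_ord_simps(1) le_SucI order_refl order_trans)
  have contr: "\<Delta> (Suc k) \<le> (1 - 1 / \<kappa>) * \<Delta> k" if "enat (Suc k) \<le> K" for k
    unfolding \<Delta>_def using state[OF prev[OF that]]
    by (intro potential_contraction[where T = T and s = s, OF step_ctx _ adm[OF that] \<kappa>]) auto
  have \<Delta>_nonneg: "0 \<le> \<Delta> k" if "enat k \<le> K" for k
    unfolding \<Delta>_def using state[OF that] V_nonneg s by simp
  have decay: "\<Delta> k \<le> (1 - 1 / \<kappa>) ^ k * (d0 + \<eta>0)" if "enat k \<le> K" for k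
    using that
  proof (induction k)
    case 0
    then show ?case using Vd0 by (simp add: \<Delta>_def init)
  next
    case (Suc k)
    have "(1 - 1 / \<kappa>) * \<Delta> k \<le> (1 - 1 / \<kappa>) * ((1 - 1 / \<kappa>) ^ k * (d0 + \<eta>0))"
      using Suc.IH[OF prev[OF Suc.prems]] \<kappa>1 by (intro mult_left_mono) auto
    then show ?case using contr[OF Suc.prems] by simp
  qed
  have d0\<eta>0: "0 \<le> d0 + \<eta>0" using Vd0 V_nonneg[OF input(1) s] input(2) by linarith
  have \<kappa>_inv: "0 < 1 / \<kappa>" "1 / \<kappa> \<le> 1" using \<kappa>1 by auto
  have \<Delta>_le: "\<Delta> k \<le> d0 + \<eta>0" if "enat k \<le> K" for k
  proof -
    have "(1 - 1 / \<kappa>) ^ k * (d0 + \<eta>0) \<le> 1 * (d0 + \<eta>0)"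
      using \<kappa>_inv d0\<eta>0 by (intro mult_right_mono power_le_one) auto
    then show ?thesis using decay[OF that] by simp
  qed

  \<comment> \<open>The factors by which \<open>d0 + \<eta>0\<close> must shrink before the residual
    test (\<open>t1\<close>) and the test on \<open>\<epsilon>\<close> (\<open>t2\<close>) are
    guaranteed to succeed.\<close>
  define t1 where "t1 = 32 * M\<^sup>2 * (d0 + \<eta>0) / ((lam * \<rho>)\<^sup>2 * m)"
  define t2 where "t2 = (d0 + \<eta>0) / (lam * (1 - \<sigma>) * \<epsilon>)"
  define L where "L = max (log_plus t1) (log_plus t2)"
  have t_nonneg: "0 \<le> t1" "0 \<le> t2" using d0\<eta>0 input reg by (auto simp: t1_def t2_def)
  have "0 \<le> log_plus t1" by (simp add: log_plus_def)
  then have L: "0 \<le> L" by (simp add: L_def)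
  \<comment> \<open>After \<open>N\<close> contractions the potential is small enough, and iteration
    \<open>Suc N\<close> starts from it. Rounding up and this shift cost one iteration each, hence
    the summand 2 in \<open>B\<close>.\<close>
  define N where "N = nat \<lceil>L * \<kappa>\<rceil>"
  have "0 \<le> L * \<kappa>" using L \<kappa>1 by simp
  then have N: "L * \<kappa> \<le> real N" "real N \<le> L * \<kappa> + 1" unfolding N_def by linarith+
  have stops: "K = enat (Suc N)" if le: "enat (Suc N) \<le> K"
  proof -
    let ?q = "(1 - 1 / \<kappa>) ^ N"
    have "log_plus t1 * \<kappa> \<le> L * \<kappa>" "log_plus t2 * \<kappa> \<le> L * \<kappa>"
      using \<kappa>1 by (simp_all add: L_def)
    then have "log_plus t1 / (1 / \<kappa>) \<le> real N" "log_plus t2 / (1 / \<kappa>) \<le> real N"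
      using N(1) by simp_all
    then have q: "?q * t1 \<le> 1" "?q * t2 \<le> 1"
      using \<kappa>_inv t_nonneg by (blast intro: geometric_decay_le_one)+
    note \<Delta>N = decay[OF prev[OF le]]
    have st: "zs N \<in> Z" "0 \<le> \<eta>s N" using state[OF prev[OF le]] by auto
    have "es (Suc N) \<le> \<Delta> N / (lam * (1 - \<sigma>))"
      unfolding \<Delta>_def by (rule step_epsilon_le[where T = T and s = s, OF step_ctx]) (use st adm[OF le] in auto)
    also have "\<dots> \<le> ?q * (d0 + \<eta>0) / (lam * (1 - \<sigma>))"
      using \<Delta>N input by (intro divide_right_mono) auto
    also have "\<dots> = (?q * t2) * \<epsilon>" using input by (simp add: t2_def)
    also have "\<dots> \<le> \<epsilon>" using mult_right_mono[OF q(2), of \<epsilon>] input by simp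
    finally have "es (Suc N) \<le> \<epsilon>" .
    moreover have "dual_seminorm p (step_residual w (ls (Suc N)) (zs N) (zs (Suc N))) \<le> ereal (\<rho> / 2)"
    proof -
      have "\<Delta> (Suc N) \<le> 1 * \<Delta> N"
        using contr[OF le] mult_right_mono[of "1 - 1 / \<kappa>" 1 "\<Delta> N"] \<Delta>_nonneg[OF prev[OF le]] \<kappa>_inv
        by linarith
      then have "V (zs (Suc N)) s \<le> V (zs N) s + \<eta>s N"
        using state[OF le] by (simp add: \<Delta>_def)
      then have "dual_seminorm p (step_residual w (ls (Suc N)) (zs N) (zs (Suc N)))
          \<le> ereal (2 * sqrt 2 * M / (lam * sqrt m) * sqrt (\<Delta> N))"
        unfolding \<Delta>_def by (intro step_residual_dual_le[where T = T and s = s, OF step_ctx _ adm[OF le]]) (use st in auto)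
      \<comment> \<open>Compared after squaring: the 8 from the residual bound and the 4 from
        \<open>(\<rho> / 2)\<^sup>2\<close> make up the 32 in \<open>t1\<close>.\<close>
      also have "2 * sqrt 2 * M / (lam * sqrt m) * sqrt (\<Delta> N) \<le> \<rho> / 2"
      proof (rule power2_le_imp_le)
        have "(2 * sqrt 2 * M / (lam * sqrt m) * sqrt (\<Delta> N))\<^sup>2 = 8 * M\<^sup>2 / (lam\<^sup>2 * m) * \<Delta> N"
          using \<Delta>_nonneg[OF prev[OF le]] reg by (simp add: power_mult_distrib power_divide)
        also have "\<dots> \<le> 8 * M\<^sup>2 / (lam\<^sup>2 * m) * (?q * (d0 + \<eta>0))"
          using \<Delta>N reg by (intro mult_left_mono) auto
        also have "\<dots> = (?q * t1) * (\<rho>\<^sup>2 / 4)"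
          using input reg by (simp add: t1_def field_simps)
        also have "\<dots> \<le> (\<rho> / 2)\<^sup>2"
          using mult_right_mono[OF q(1), of "\<rho>\<^sup>2 / 4"] by (simp add: power_divide)
        finally show "(2 * sqrt 2 * M / (lam * sqrt m) * sqrt (\<Delta> N))\<^sup>2 \<le> (\<rho> / 2)\<^sup>2" .
      qed (use input in simp)
      finally show ?thesis by simp
    qed
    ultimately show ?thesis using stop[of "Suc N"] le by (simp add: stop_test_def)
  qed
  \<comment> \<open>This also excludes an infinite run: it would reach iteration
    \<open>Suc N\<close> and stop there.\<close>
  obtain n where n: "K = enat n" "n \<le> Suc N"
  proof (cases "enat (Suc N) \<le> K")
    case True
    then show thesis using stops that by blast
  next
    case False
    then show thesis using that by (cases K) auto
  qed
  have n1: "1 \<le> n" using K1 n(1) by (simp add: one_enat_def)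
  have "real n \<le> L * \<kappa> + 2" using n(2) N(2) by linarith
  also have "\<dots> \<le> \<kappa> * (2 + L)" using \<kappa>1 by (simp add: algebra_simps)
  also have "\<dots> = B" by (simp add: B \<kappa>_def L_def t1_def t2_def)
  finally have nB: "real n \<le> B" .
  have "stop_test p \<rho> \<epsilon> (step_residual w (ls n) (zs (n - 1)) (zs n)) (es n)"
    using stop[OF n1] n(1) by simp
  then have r: "dual_seminorm p (step_residual w (ls n) (zs (n - 1)) (zs n)) \<le> ereal (\<rho> / 2)"
    and e: "es n \<le> \<epsilon>" by (auto simp: stop_test_def)
  \<comment> \<open>The potential never exceeds \<open>d0 + \<eta>0\<close>, so the one-step bound
    holds with this same constant at every iteration.\<close>
  have b: "dual_seminorm p (grad (bregman w z0) (zts k)) \<le> ereal D0" if k: "k \<in> {1..n}" for k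
  proof -
    obtain j where j: "k = Suc j" using k by (cases k) auto
    have le: "enat (Suc j) \<le> K" using k n(1) j by simp
    have st: "zs j \<in> Z" "0 \<le> \<eta>s j" using state[OF prev[OF le]] by auto
    show ?thesis unfolding j D0
      by (rule predictor_dual_le[where T = T and s = s, OF step_ctx _ adm[OF le]])
        (use st \<Delta>_le[OF prev[OF le]] Vd0 input in \<open>auto simp: \<Delta>_def\<close>)
  qed
  have D0_nonneg: "0 \<le> D0"
    unfolding D0 using reg input d0\<eta>0 by (intro mult_nonneg_nonneg add_nonneg_nonneg) auto
  let ?r = "step_residual w (ls n) (zs (n - 1)) (zs n)" and ?g = "grad (bregman w z0) (zts n)"
  have c: "dual_seminorm p (?r - \<mu> *\<^sub>R ?g) \<le> ereal \<rho>" if "2 * D0 \<le> D"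
  proof -
    have "dual_seminorm p (\<mu> *\<^sub>R ?g) \<le> ereal (\<mu> * D0)"
      using b[of n] n1 \<mu> D0_nonneg by (intro dual_seminorm_scaleR_le[OF seminorm]) auto
    then have "dual_seminorm p (?r - \<mu> *\<^sub>R ?g) \<le> ereal (\<rho> / 2 + \<mu> * D0)"
      using r input \<mu> D0_nonneg by (intro dual_seminorm_diff_le[OF seminorm]) auto
    \<comment> \<open>As \<open>\<mu> = \<rho> / D\<close>, the assumption
      \<open>2 * D0 \<le> D\<close> gives \<open>\<mu> * D0 \<le> \<rho> / 2\<close>.\<close>
    also have "\<rho> / 2 + \<mu> * D0 \<le> \<rho>"
      using mult_left_mono[OF that, of \<rho>] input by (simp add: mu field_simps)
    finally show ?thesis by simp
  qed
  have a: "?r - \<mu> *\<^sub>R ?g \<in> enlargement T (es n) (zts n)"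
  proof -
    obtain j where "n = Suc j" using n1 by (cases n) auto
    then show ?thesis using adm[of j] n(1) by (auto simp: admissible_step_def)
  qed
  show ?thesis
    using n(1) n1 nB a r e b c by (intro exI[of _ n]) (simp add: Let_def)
qed

end
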